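(* Let $\epsilon>0$, let $w^0,w^1,w^2,\dots:\mathbb{I}\to[0,1]$ be arbitrary weight functions, let $x_\epsilon^0$ be any point in $\mathbb{R}^n$, and let $x_\epsilon^1,x_\epsilon^2,x_\epsilon^3,\dots\in\mathbb{R}^n$ be the sequence of points defined by $$x_\epsilon^{k+1}=\left(\sum_{\iota\in\mathbb{I}}w^k(\iota)P^\epsilon[\iota](x_\epsilon^k)\right)+\boldsymbol{v}^k\qquad\text{for all }k\ge 0,$$ where $\boldsymbol{v}^0,\boldsymbol{v}^1,\boldsymbol{v}^2,\dots$ is a sequence of vectors in $\mathbb{R}^n$ such that $\sum_{k=0}^\infty\|\boldsymbol{v}^k\|$ converges. Then the sequence $x_\epsilon^1,x_\epsilon^2,x_\epsilon^3,\dots$ converges. Moreover, if $p$ is the limit of this sequence then $d(p,C_j)\le\epsilon$ for every index $j$ such that $\sum_{k=0}^\infty\sum_{\iota\in\mathbb{I}\langle j\rangle}w^k(\iota)=\infty$.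
   Context: Fix a positive integer $n$ and an infinite sequence $C_1,C_2,C_3,\dots$ of closed convex subsets of $\mathbb{R}^n$ such that $\bigcap_{i=1}^\infty C_i\neq\emptyset$ and at least one $C_i$ is not $\mathbb{R}^n$. For $q\in\mathbb{R}^n$ and nonempty $Z\subseteq\mathbb{R}^n$, $d(q,Z)=\inf_{z\in Z}\|q-z\|$ (Euclidean norm). An index is a positive integer. For each index $j$, $P_j:\mathbb{R}^n\to C_j$ maps each $q$ to the unique point of $C_j$ closest to $q$. For $\epsilon>0$, $P_j^\epsilon:\mathbb{R}^n\to\mathbb{R}^n$ is defined by $P_j^\epsilon(x)=P_j(x)$ if $\|x-P_j(x)\|\ge\epsilon$, and $P_j^\epsilon(x)=x$ if $\|x-P_j(x)\|<\epsilon$. $\mathbb{I}$ is the set of all nonempty finite sequences of indices (repetitions allowed); its members are called index vectors. For $\iota=(\iota_1,\dots,\iota_m)\in\mathbb{I}$, $P^\epsilon[\iota]=P^\epsilon_{\iota_m}\circ P^\epsilon_{\iota_{m-1}}\circ\dots\circ P^\epsilon_{\iota_1}$. For an index $j$, $\mathbb{I}\langle j\rangle$ is the set of index vectors in which $j$ occurs. A weight function is a function $w:\mathbb{I}\to[0,1]$ with finite support such that $\sum_{\iota\in\mathbb{I}}w(\iota)=1$. *)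

theory Defs
  imports "HOL-Analysis.Analysis"
begin

(* Indices are positive integers, represented by naturals j \<ge> 1: the value C 0 of a
   sequence C :: nat \<Rightarrow> _ is never used. *)
definition indices :: "nat set" where
  "indices = {1..}"

definition index_vectors :: "nat list set" where
  "index_vectors = {\<iota>. \<iota> \<noteq> [] \<and> set \<iota> \<subseteq> indices}"

definition index_vectors_at :: "nat \<Rightarrow> nat list set" where
  "index_vectors_at j = {\<iota> \<in> index_vectors. j \<in> set \<iota>}"

definition proj_eps :: "(nat \<Rightarrow> (real ^ 'n) set) \<Rightarrow> real \<Rightarrow> nat \<Rightarrow> real ^ 'n \<Rightarrow> real ^ 'n" where
  "proj_eps C \<epsilon> j x =
     (if norm (x - closest_point (C j) x) \<ge> \<epsilon> then closest_point (C j) x else x)"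

(* fold applies the head of the list first, so the first entry of the index vector is the
   innermost map of the composition. *)
definition proj_eps_vec ::
    "(nat \<Rightarrow> (real ^ 'n) set) \<Rightarrow> real \<Rightarrow> nat list \<Rightarrow> real ^ 'n \<Rightarrow> real ^ 'n" where
  "proj_eps_vec C \<epsilon> \<iota> = fold (proj_eps C \<epsilon>) \<iota>"

(* A function on index vectors is a total function on lists whose values outside
   index_vectors are ignored. *)
definition weight_function :: "(nat list \<Rightarrow> real) \<Rightarrow> bool" where
  "weight_function w \<longleftrightarrow>
     (\<forall>\<iota>\<in>index_vectors. 0 \<le> w \<iota> \<and> w \<iota> \<le> 1) \<and>
     finite {\<iota> \<in> index_vectors. w \<iota> \<noteq> 0} \<and>
     (\<Sum>\<^sub>\<infinity>\<iota>\<in>index_vectors. w \<iota>) = 1"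

end

theory Submission
  imports Defs
begin

text \<open>
  Fix a common point \<open>z\<close> of all the \<open>C i\<close>. Projecting onto a closed convex set that contains \<open>z\<close>
  by a step of length \<open>s\<close> decreases the squared distance to \<open>z\<close> by at least \<open>s\<^sup>2\<close>. The point of the
  threshold \<open>\<epsilon>\<close> is that every nontrivial step has \<open>s \<ge> \<epsilon>\<close>, hence \<open>s\<^sup>2 \<ge> \<epsilon> s\<close>: the decrease of the
  squared distance controls the length travelled, not only its square. Summed along an index
  vector, this bounds the displacement of the point by the decrease divided by \<open>\<epsilon>\<close>, however long
  the index vector is (\<open>proj_eps_vec_displacement\<close>).

  Let \<open>r k\<close> be the decrease of the squared distance to \<open>z\<close> in step \<open>k\<close>, averaged with the weights
  \<open>w k\<close>. By convexity of the squared norm the averaged point is at least as close to \<open>z\<close>, and since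
  the iterates are bounded, the perturbation \<open>v k\<close> increases the squared distance by at most a constant
  times its norm. Telescoping shows that \<open>r\<close> is summable. As the length of step \<open>k\<close> is at most
  \<open>r k / \<epsilon> + norm (v k)\<close>, the iterates have finite total length and converge.

  If the limit has distance more than \<open>\<epsilon>\<close> from \<open>C j\<close>, then so have almost all iterates. Starting
  from such an iterate, an index vector containing \<open>j\<close> makes at least one nontrivial step, at the
  latest when it reaches \<open>j\<close>, so it decreases the squared distance by at least \<open>\<epsilon>\<^sup>2\<close>
  (\<open>proj_eps_vec_decrease\<close>). Hence \<open>\<epsilon>\<^sup>2\<close> times the weight of these index vectors is at most \<open>r k\<close>, and
  the total weight is finite.
\<close>

section \<open>Thresholded projections\<close>

text \<open>The angle at the projection between \<open>x\<close> and any point of \<open>S\<close> is at least a right angle.\<close>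

lemma closest_point_Pythagoras:
  fixes x z :: "'a::euclidean_space"
  assumes "closed S" "convex S" "z \<in> S"
  shows "(norm (closest_point S x - z))\<^sup>2 + (norm (x - closest_point S x))\<^sup>2 \<le> (norm (x - z))\<^sup>2"
proof -
  let ?c = "closest_point S x"
  have "(x - ?c) \<bullet> (z - ?c) \<le> 0"
    using closest_point_dot[OF assms(2,1,3)] .
  then show ?thesis
    unfolding power2_norm_eq_inner by (simp add: inner_diff inner_commute algebra_simps)
qed

lemma proj_eps_dichotomy [consumes 3, case_names stay move]:
  assumes "closed (C i)" "convex (C i)" "z \<in> C i"
  obtains (stay) "proj_eps C \<epsilon> i x = x" "norm (x - closest_point (C i) x) < \<epsilon>"
    | (move) "norm (proj_eps C \<epsilon> i x - x) \<ge> \<epsilon>"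
        "(norm (proj_eps C \<epsilon> i x - z))\<^sup>2 + (norm (proj_eps C \<epsilon> i x - x))\<^sup>2 \<le> (norm (x - z))\<^sup>2"
  using closest_point_Pythagoras[OF assms, of x]
  by (cases "norm (x - closest_point (C i) x) \<ge> \<epsilon>") (auto simp: proj_eps_def norm_minus_commute)

text \<open>The key estimate. The steps of a composition add up on both sides, by the triangle inequality
  on the left and by telescoping on the right, so that the bound does not depend on their number.\<close>

lemma proj_eps_vec_displacement:
  assumes "\<And>i. i \<in> set \<iota> \<Longrightarrow> closed (C i) \<and> convex (C i) \<and> z \<in> C i" and "\<epsilon> > 0"
  shows "\<epsilon> * norm (proj_eps_vec C \<epsilon> \<iota> x - x)
           \<le> (norm (x - z))\<^sup>2 - (norm (proj_eps_vec C \<epsilon> \<iota> x - z))\<^sup>2"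
  using assms(1)
proof (induction \<iota> arbitrary: x)
  case Nil
  then show ?case by (simp add: proj_eps_vec_def)
next
  case (Cons i \<iota>)
  let ?y = "proj_eps C \<epsilon> i x"
  let ?q = "proj_eps_vec C \<epsilon> \<iota> ?y"
  have q: "proj_eps_vec C \<epsilon> (i # \<iota>) x = ?q"
    by (simp add: proj_eps_vec_def)
  have IH: "\<epsilon> * norm (?q - ?y) \<le> (norm (?y - z))\<^sup>2 - (norm (?q - z))\<^sup>2"
    using Cons by simp
  have i: "closed (C i)" "convex (C i)" "z \<in> C i"
    using Cons.prems by auto
  have first: "\<epsilon> * norm (?y - x) \<le> (norm (x - z))\<^sup>2 - (norm (?y - z))\<^sup>2"
    using i
  proof (cases rule: proj_eps_dichotomy[where \<epsilon> = \<epsilon> and x = x])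
    case stay
    then show ?thesis by simp
  next
    case move
    have "\<epsilon> * norm (?y - x) \<le> (norm (?y - x))\<^sup>2"
      unfolding power2_eq_square by (intro mult_right_mono move norm_ge_zero)
    with move show ?thesis by linarith
  qed
  have "norm (?q - x) \<le> norm (?q - ?y) + norm (?y - x)"
    using norm_triangle_ineq[of "?q - ?y" "?y - x"] by simp
  then have "\<epsilon> * norm (?q - x) \<le> \<epsilon> * norm (?q - ?y) + \<epsilon> * norm (?y - x)"
    using \<open>\<epsilon> > 0\<close> by (metis distrib_left mult_left_mono less_imp_le)
  with IH first show ?case
    unfolding q by linarith
qed

corollary proj_eps_vec_Fejer:
  assumes "\<And>i. i \<in> set \<iota> \<Longrightarrow> closed (C i) \<and> convex (C i) \<and> z \<in> C i" and "\<epsilon> > 0"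
  shows "(norm (proj_eps_vec C \<epsilon> \<iota> x - z))\<^sup>2 \<le> (norm (x - z))\<^sup>2"
proof -
  have "0 \<le> \<epsilon> * norm (proj_eps_vec C \<epsilon> \<iota> x - x)"
    using \<open>\<epsilon> > 0\<close> by simp
  with proj_eps_vec_displacement[of \<iota> C z \<epsilon> x, OF assms] show ?thesis
    by linarith
qed

text \<open>As long as no step is nontrivial, the point is still \<open>x\<close> when \<open>j\<close> is reached, and there it
  has to move. So some step has length at least \<open>\<epsilon>\<close>, and the steps after it do not increase the
  distance to \<open>z\<close>.\<close>

lemma proj_eps_vec_decrease:
  assumes "\<And>i. i \<in> set \<iota> \<Longrightarrow> closed (C i) \<and> convex (C i) \<and> z \<in> C i" and "\<epsilon> > 0"
    and "j \<in> set \<iota>" and far: "norm (x - closest_point (C j) x) \<ge> \<epsilon>"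
  shows "\<epsilon>\<^sup>2 \<le> (norm (x - z))\<^sup>2 - (norm (proj_eps_vec C \<epsilon> \<iota> x - z))\<^sup>2"
  using assms(1,3)
proof (induction \<iota>)
  case Nil
  then show ?case by simp
next
  case (Cons i \<iota>)
  let ?y = "proj_eps C \<epsilon> i x"
  have q: "proj_eps_vec C \<epsilon> (i # \<iota>) x = proj_eps_vec C \<epsilon> \<iota> ?y"
    by (simp add: proj_eps_vec_def)
  have i: "closed (C i)" "convex (C i)" "z \<in> C i"
    using Cons.prems by auto
  show ?case
    using i
  proof (cases rule: proj_eps_dichotomy[where \<epsilon> = \<epsilon> and x = x])
    case stay
    with far have "j \<in> set \<iota>"
      using Cons.prems(2) by auto
    with Cons stay q show ?thesis by simp
  next
    case move
    have "(norm (proj_eps_vec C \<epsilon> \<iota> ?y - z))\<^sup>2 \<le> (norm (?y - z))\<^sup>2"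
      using Cons.prems(1) by (intro proj_eps_vec_Fejer \<open>\<epsilon> > 0\<close>) auto
    moreover have "\<epsilon>\<^sup>2 \<le> (norm (?y - x))\<^sup>2"
      using move(1) \<open>\<epsilon> > 0\<close> by (intro power_mono) auto
    ultimately show ?thesis
      using move(2) unfolding q by linarith
  qed
qed

section \<open>Weighted averages and perturbed decrease\<close>

text \<open>Averaging \<open>0 \<le> (norm (q i - m))\<^sup>2\<close>, where \<open>m\<close> is the mean of the \<open>q i\<close>, gives this instance of
  Jensen's inequality.\<close>

lemma norm_mean_square_le:
  fixes q :: "'i \<Rightarrow> 'a::real_inner"
  assumes "\<And>i. i \<in> F \<Longrightarrow> 0 \<le> u i" and "(\<Sum>i\<in>F. u i) = 1"
  shows "(norm (\<Sum>i\<in>F. u i *\<^sub>R q i))\<^sup>2 \<le> (\<Sum>i\<in>F. u i * (norm (q i))\<^sup>2)"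
proof -
  define m where "m = (\<Sum>i\<in>F. u i *\<^sub>R q i)"
  have "0 \<le> (\<Sum>i\<in>F. u i * (norm (q i - m))\<^sup>2)"
    using assms(1) by (intro sum_nonneg mult_nonneg_nonneg) auto
  also have "\<dots> = (\<Sum>i\<in>F. u i * (norm (q i))\<^sup>2 - 2 * ((u i *\<^sub>R q i) \<bullet> m) + u i * (norm m)\<^sup>2)"
    by (intro sum.cong refl)
      (simp add: power2_norm_eq_inner inner_diff inner_commute algebra_simps)
  also have "\<dots> = (\<Sum>i\<in>F. u i * (norm (q i))\<^sup>2) - 2 * (m \<bullet> m) + (norm m)\<^sup>2"
    by (simp only: sum.distrib sum_subtractf flip: sum_distrib_left sum_distrib_right inner_sum_left)
      (simp add: assms(2) m_def)
  finally show ?thesis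
    unfolding m_def[symmetric] by (simp add: power2_norm_eq_inner)
qed

lemma summable_perturbed_decrease:
  fixes a b r :: "nat \<Rightarrow> real"
  assumes "\<And>k. 0 \<le> a k" "\<And>k. 0 \<le> r k" "\<And>k. 0 \<le> b k" "summable b"
    and "\<And>k. r k \<le> a k - a (Suc k) + b k"
  shows "summable r"
proof (rule summableI_nonneg_bounded[where x = "a 0 + suminf b"])
  fix n
  have "(\<Sum>k<n. r k) \<le> (\<Sum>k<n. a k - a (Suc k) + b k)"
    by (intro sum_mono assms)
  also have "\<dots> = a 0 - a n + (\<Sum>k<n. b k)"
    by (simp add: sum.distrib sum_lessThan_telescope')
  also have "\<dots> \<le> a 0 + suminf b"
    using sum_le_suminf[OF assms(4), of "{..<n}"] assms(1)[of n] assms(3) by simp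
  finally show "(\<Sum>k<n. r k) \<le> a 0 + suminf b" .
qed (use assms in auto)

lemma convergent_if_finite_length:
  fixes x :: "nat \<Rightarrow> 'a::banach"
  assumes "summable (\<lambda>k. norm (x (Suc k) - x k))"
  shows "convergent x"
proof -
  have "convergent (\<lambda>n. \<Sum>k<n. x (Suc k) - x k)"
    using summable_norm_cancel[OF assms] by (simp add: summable_iff_convergent)
  then have "convergent (\<lambda>n. x n - x 0)"
    by (simp add: sum_lessThan_telescope)
  then show ?thesis
    using convergent_diff_const_right_iff by blast
qed

lemma infsum_eq_sum_of_support:
  fixes f :: "'i \<Rightarrow> 'a::{topological_comm_monoid_add, t2_space}"
  assumes "finite F" "F \<subseteq> A" "\<And>i. i \<in> A - F \<Longrightarrow> f i = 0"
  shows "infsum f A = sum f F"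
proof -
  have "infsum f A = infsum f F"
    using assms by (intro infsum_cong_neutral) auto
  with \<open>finite F\<close> show ?thesis
    by simp
qed

section \<open>Convergence of the perturbed averaged iteration\<close>

theorem theorem6p1:
  fixes C :: "nat \<Rightarrow> (real ^ 'n) set"
    and \<epsilon> :: real
    and w :: "nat \<Rightarrow> nat list \<Rightarrow> real"
    and x v :: "nat \<Rightarrow> real ^ 'n"
  assumes "\<And>i. i \<in> indices \<Longrightarrow> closed (C i)"
    and "\<And>i. i \<in> indices \<Longrightarrow> convex (C i)"
    and "(\<Inter>i\<in>indices. C i) \<noteq> {}"
    and "\<exists>i\<in>indices. C i \<noteq> UNIV"
    and "\<epsilon> > 0"
    and "\<And>k. weight_function (w k)"
    and "summable (\<lambda>k. norm (v k))"
    and "\<And>k. x (Suc k) =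
           (\<Sum>\<^sub>\<infinity>\<iota>\<in>index_vectors. w k \<iota> *\<^sub>R proj_eps_vec C \<epsilon> \<iota> (x k)) + v k"
  shows "convergent (\<lambda>k. x (Suc k)) \<and>
         (\<forall>p. (\<lambda>k. x (Suc k)) \<longlonglongrightarrow> p \<longrightarrow>
            (\<forall>j\<in>indices.
               (\<Sum>k. ennreal (\<Sum>\<^sub>\<infinity>\<iota>\<in>index_vectors_at j. w k \<iota>)) = \<infinity> \<longrightarrow>
               infdist p (C j) \<le> \<epsilon>))"
proof -
  obtain z where z: "\<And>i. i \<in> indices \<Longrightarrow> z \<in> C i"
    using assms(3) by auto
  define F where "F k = {\<iota> \<in> index_vectors. w k \<iota> \<noteq> 0}" for k
  define P where "P k \<iota> = proj_eps_vec C \<epsilon> \<iota> (x k)" for k \<iota>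
  define y where "y k = (\<Sum>\<iota>\<in>F k. w k \<iota> *\<^sub>R P k \<iota>)" for k
  define a where "a k = (norm (x k - z))\<^sup>2" for k
  define r where "r k = (\<Sum>\<iota>\<in>F k. w k \<iota> * (a k - (norm (P k \<iota> - z))\<^sup>2))" for k
  have finF: "finite (F k)" and w_nonneg: "\<iota> \<in> F k \<Longrightarrow> 0 \<le> w k \<iota>" for k \<iota>
    using assms(6)[of k] by (auto simp: F_def weight_function_def)
  have good: "closed (C i) \<and> convex (C i) \<and> z \<in> C i" if "\<iota> \<in> F k" "i \<in> set \<iota>" for k i \<iota>
    using that assms(1,2) z by (auto simp: F_def index_vectors_def)
  have sum_w: "(\<Sum>\<iota>\<in>F k. w k \<iota>) = 1" for k
  proof -
    have "(\<Sum>\<^sub>\<infinity>\<iota>\<in>index_vectors. w k \<iota>) = (\<Sum>\<iota>\<in>F k. w k \<iota>)"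
      by (intro infsum_eq_sum_of_support finF) (auto simp: F_def)
    then show ?thesis
      using assms(6)[of k] by (simp add: weight_function_def)
  qed
  have x_Suc: "x (Suc k) = y k + v k" for k
    unfolding assms(8)[of k] y_def P_def
    by (subst infsum_eq_sum_of_support[OF finF[of k]]) (auto simp: F_def)

  have r_alt: "r k = a k - (\<Sum>\<iota>\<in>F k. w k \<iota> * (norm (P k \<iota> - z))\<^sup>2)" for k
    by (simp add: r_def right_diff_distrib sum_subtractf sum_w flip: sum_distrib_right)
  have decrease_nonneg: "0 \<le> a k - (norm (P k \<iota> - z))\<^sup>2" if "\<iota> \<in> F k" for k \<iota>
    using proj_eps_vec_Fejer[of \<iota> C z \<epsilon> "x k"] good[OF that] \<open>\<epsilon> > 0\<close> by (simp add: a_def P_def)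
  have r_nonneg: "0 \<le> r k" for k
    unfolding r_def by (intro sum_nonneg mult_nonneg_nonneg w_nonneg decrease_nonneg)
  have y_decrease: "(norm (y k - z))\<^sup>2 \<le> a k - r k" for k
  proof -
    have y: "y k - z = (\<Sum>\<iota>\<in>F k. w k \<iota> *\<^sub>R (P k \<iota> - z))"
      by (simp add: y_def scaleR_diff_right sum_subtractf sum_w flip: scaleR_sum_left)
    have "(norm (y k - z))\<^sup>2 \<le> (\<Sum>\<iota>\<in>F k. w k \<iota> * (norm (P k \<iota> - z))\<^sup>2)"
      unfolding y by (intro norm_mean_square_le w_nonneg sum_w)
    with r_alt[of k] show ?thesis
      by linarith
  qed
  have y_le: "norm (y k - z) \<le> norm (x k - z)" for k
  proof (rule power2_le_imp_le[OF _ norm_ge_zero])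
    show "(norm (y k - z))\<^sup>2 \<le> (norm (x k - z))\<^sup>2"
      using y_decrease[of k] r_nonneg[of k] unfolding a_def by linarith
  qed
  have x_Suc_le: "norm (x (Suc k) - z) \<le> norm (y k - z) + norm (v k)" for k
    using norm_triangle_ineq[of "y k - z" "v k"] by (simp add: x_Suc algebra_simps)

  have displacement: "norm (y k - x k) \<le> r k / \<epsilon>" for k
  proof -
    have "y k - x k = (\<Sum>\<iota>\<in>F k. w k \<iota> *\<^sub>R (P k \<iota> - x k))"
      by (simp add: y_def scaleR_diff_right sum_subtractf sum_w flip: scaleR_sum_left)
    then have "norm (y k - x k) \<le> (\<Sum>\<iota>\<in>F k. w k \<iota> * norm (P k \<iota> - x k))"
      using w_nonneg by (simp add: sum_norm_le)
    also have "\<dots> \<le> (\<Sum>\<iota>\<in>F k. w k \<iota> * ((a k - (norm (P k \<iota> - z))\<^sup>2) / \<epsilon>))"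
    proof (intro sum_mono mult_left_mono w_nonneg)
      fix \<iota> assume "\<iota> \<in> F k"
      then show "norm (P k \<iota> - x k) \<le> (a k - (norm (P k \<iota> - z))\<^sup>2) / \<epsilon>"
        using proj_eps_vec_displacement[of \<iota> C z \<epsilon> "x k"] good \<open>\<epsilon> > 0\<close>
        by (simp add: a_def P_def field_simps)
    qed
    also have "\<dots> = r k / \<epsilon>"
      by (simp add: r_def sum_divide_distrib)
    finally show ?thesis .
  qed

  \<comment> \<open>Averaging does not move the iterates away from \<open>z\<close>, so only the perturbations can, and their
    norms have finite sum. This bound is what makes their effect on squared distances linear.\<close>
  define D where "D = norm (x 0 - z) + (\<Sum>k. norm (v k))"
  have bounded: "norm (x k - z) \<le> D" for k
  proof -
    have "norm (x k - z) \<le> norm (x 0 - z) + (\<Sum>i<k. norm (v i))"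
    proof (induction k)
      case (Suc k)
      then show ?case using x_Suc_le[of k] y_le[of k] by simp
    qed simp
    also have "\<dots> \<le> D"
      unfolding D_def using sum_le_suminf[OF assms(7), of "{..<k}"] by simp
    finally show ?thesis .
  qed
  have r_le: "r k \<le> a k - a (Suc k) + 2 * D * norm (v k)" for k
  proof -
    define s t where "s = norm (x (Suc k) - z)" and "t = norm (y k - z)"
    have st: "0 \<le> s" "0 \<le> t" "s \<le> D" "t \<le> D" "s - t \<le> norm (v k)"
      using bounded[of k] bounded[of "Suc k"] y_le[of k] x_Suc_le[of k]
      by (auto simp: s_def t_def)
    have "s\<^sup>2 - t\<^sup>2 = (s - t) * (s + t)"
      by (simp add: power2_eq_square algebra_simps)
    also have "\<dots> \<le> norm (v k) * (s + t)"
      using st by (intro mult_right_mono) auto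
    also have "\<dots> \<le> norm (v k) * (2 * D)"
      using st by (intro mult_left_mono) auto
    finally have "s\<^sup>2 - t\<^sup>2 \<le> 2 * D * norm (v k)"
      by (simp add: mult.commute)
    then show ?thesis
      using y_decrease[of k] by (simp add: a_def s_def t_def)
  qed
  have "0 \<le> D"
    using bounded[of 0] norm_ge_zero order_trans by blast
  have r_summable: "summable r"
    by (rule summable_perturbed_decrease[where a = a and b = "\<lambda>k. 2 * D * norm (v k)"])
      (use r_nonneg r_le \<open>0 \<le> D\<close> in \<open>auto simp: a_def intro!: summable_mult assms(7)\<close>)

  have "summable (\<lambda>k. norm (x (Suc k) - x k))"
  proof (rule summable_comparison_test')
    show "summable (\<lambda>k. r k / \<epsilon> + norm (v k))"
      by (intro summable_add summable_divide r_summable assms(7))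
    show "norm (norm (x (Suc k) - x k)) \<le> r k / \<epsilon> + norm (v k)" for k
      using norm_triangle_ineq[of "y k - x k" "v k"] displacement[of k]
      by (simp add: x_Suc algebra_simps)
  qed
  then have "convergent (\<lambda>k. x (Suc k))"
    using convergent_if_finite_length convergent_Suc_iff by blast
  moreover have "infdist p (C j) \<le> \<epsilon>"
    if lim: "(\<lambda>k. x (Suc k)) \<longlonglongrightarrow> p" and j: "j \<in> indices"
      and inf: "(\<Sum>k. ennreal (\<Sum>\<^sub>\<infinity>\<iota>\<in>index_vectors_at j. w k \<iota>)) = \<infinity>" for p j
  proof (rule ccontr)
    define W where "W k = (\<Sum>\<^sub>\<infinity>\<iota>\<in>index_vectors_at j. w k \<iota>)" for k
    define G where "G k = {\<iota> \<in> F k. j \<in> set \<iota>}" for k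
    have G: "finite (G k)" "G k \<subseteq> F k" for k
      using finF[of k] by (auto simp: G_def)
    have W: "W k = (\<Sum>\<iota>\<in>G k. w k \<iota>)" for k
      unfolding W_def
      by (intro infsum_eq_sum_of_support G) (auto simp: G_def F_def index_vectors_at_def)
    have W_nonneg: "0 \<le> W k" for k
      unfolding W using G(2)[of k] w_nonneg[of _ k] by (intro sum_nonneg) blast
    assume "\<not> infdist p (C j) \<le> \<epsilon>"
    moreover have "(\<lambda>k. infdist (x k) (C j)) \<longlonglongrightarrow> infdist p (C j)"
      using lim by (intro tendsto_infdist) (simp add: filterlim_sequentially_Suc)
    ultimately have "\<forall>\<^sub>F k in sequentially. \<epsilon> < infdist (x k) (C j)"
      by (intro order_tendstoD) auto
    then obtain N where N: "\<And>k. k \<ge> N \<Longrightarrow> \<epsilon> < infdist (x k) (C j)"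
      by (auto simp: eventually_sequentially)
    have W_le: "\<epsilon>\<^sup>2 * W k \<le> r k" if "k \<ge> N" for k
    proof -
      \<comment> \<open>The distance is attained at the projection, so \<open>x k\<close> lies beyond the threshold for \<open>j\<close>.\<close>
      have "closest_point (C j) (x k) \<in> C j"
        using closest_point_in_set[of "C j"] assms(1) z j by auto
      then have far: "\<epsilon> \<le> norm (x k - closest_point (C j) (x k))"
        using N[OF that] infdist_le[of "closest_point (C j) (x k)" "C j" "x k"]
        by (simp add: dist_norm)
      have "\<epsilon>\<^sup>2 * W k = (\<Sum>\<iota>\<in>G k. w k \<iota> * \<epsilon>\<^sup>2)"
        by (simp add: W mult.commute[of "\<epsilon>\<^sup>2"] sum_distrib_right)
      also have "\<dots> \<le> (\<Sum>\<iota>\<in>G k. w k \<iota> * (a k - (norm (P k \<iota> - z))\<^sup>2))"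
      proof (intro sum_mono mult_left_mono)
        fix \<iota> assume "\<iota> \<in> G k"
        then show "\<epsilon>\<^sup>2 \<le> a k - (norm (P k \<iota> - z))\<^sup>2" "0 \<le> w k \<iota>"
          using proj_eps_vec_decrease[of \<iota> C z \<epsilon> j "x k"] good far w_nonneg \<open>\<epsilon> > 0\<close>
          by (auto simp: a_def P_def G_def)
      qed
      also have "\<dots> \<le> r k"
        unfolding r_def
        by (intro sum_mono2 mult_nonneg_nonneg finF G w_nonneg decrease_nonneg) auto
      finally show ?thesis .
    qed
    have "summable W"
    proof (rule summable_comparison_test'[where N = N])
      show "summable (\<lambda>k. r k / \<epsilon>\<^sup>2)"
        by (intro summable_divide r_summable)
      show "norm (W k) \<le> r k / \<epsilon>\<^sup>2" if "k \<ge> N" for k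
        using W_le[OF that] W_nonneg[of k] \<open>\<epsilon> > 0\<close> by (simp add: field_simps)
    qed
    then have "(\<Sum>k. ennreal (W k)) \<noteq> \<infinity>"
      using ennreal_suminf_neq_top W_nonneg by auto
    with inf show False
      by (simp add: W_def)
  qed
  ultimately show ?thesis
    by blast
qed

end
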